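(* Let $f\colon T\to\mathbb{R}$ be a discrete Morse function on a tree $T$. Then $f$ induces a merge tree $M_f=M$.
   Context: Graphs are finite, without loops or multiple edges; a simplex of a graph is a vertex or an edge. A tree is a connected graph without cycles. A function $f\colon G\to\mathbb{R}$ on the simplices of a graph $G$ is weakly increasing if $f(v)\le f(e)$ whenever $v\subseteq e$. A discrete Morse function is a weakly increasing function which is at most 2--1 and such that if $f(\sigma)=f(\tau)$, then $\sigma\subseteq\tau$ or $\tau\subseteq\sigma$. A simplex $\sigma$ on which $f$ is 1--1 (no other simplex has the value $f(\sigma)$) is critical, and $f(\sigma)$ is then a critical value. A binary tree is a rooted tree where each vertex has at most two children, and each child is designated as its left (L) or right (R) child. It is full if every vertex has $0$ or $2$ children. A merge tree is a full binary tree; its vertices are called nodes. For $a\in\mathbb{R}$, $T_a$ is the subgraph of $T$ consisting of all simplices $\sigma$ with $f(\sigma)\le a$. For a critical value $c_i$, $T_{c_i-\epsilon}$ is the level subcomplex immediately preceding $T_{c_i}$: $\epsilon$ is chosen so that $f(\sigma)<c_i-\epsilon<c_i$ for every $\sigma$ with $f(\sigma)<c_i$. For a vertex $w$, $T_{c_i-\epsilon}[w]$ is the connected component of $T_{c_i-\epsilon}$ containing $w$. Meaning of "induces": $M_f$ denotes the merge tree obtained as follows. Let $c_0<c_1<\dots<c_m$ be the critical values of $f$. Nodes of $M$ correspond to critical values; each node is labeled by a real number via a function $f_M$ and is given a direction L or R. Begin with a node $n_{c_m}$ corresponding to the critical edge of $T$ labeled $c_m$, with $f_M(n_{c_m})=c_m$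 and direction L. Inductively, if $n_{c_i}$ is a node corresponding to a critical edge $uv$, create two child nodes $n_u,n_v$ of $n_{c_i}$ with $f_M(n_u)=\max\{f(\sigma):\sigma\in T_{c_i-\epsilon}[u],\ \sigma\text{ critical}\}$ and $f_M(n_v)=\max\{f(\sigma):\sigma\in T_{c_i-\epsilon}[v],\ \sigma\text{ critical}\}$. If $\min\{f(\sigma):\sigma\in T_{c_i-\epsilon}[u],\ \sigma\text{ critical}\}<\min\{f(\sigma):\sigma\in T_{c_i-\epsilon}[v],\ \sigma\text{ critical}\}$, give $n_u$ the same direction (L or R) as $n_{c_i}$ and give $n_v$ the opposite direction (the names $u,v$ of the endpoints being interchangeable). Continue over all critical edges. *)

theory Defs
  imports Complex_Main "HOL-Library.Tree"
begin

section \<open>Finite simple graphs\<close>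

record 'a graph =
  verts :: "'a set"
  edges :: "'a set set"

definition is_graph :: "'a graph \<Rightarrow> bool" where
  "is_graph G \<longleftrightarrow> finite (verts G) \<and> (\<forall>e\<in>edges G. e \<subseteq> verts G \<and> card e = 2)"

text \<open>The vertex \<open>v\<close>, regarded as a simplex, is the singleton \<open>{v}\<close>, so that the face
  relation between simplices is set inclusion.\<close>

definition simplices :: "'a graph \<Rightarrow> 'a set set" where
  "simplices G = {{v} | v. v \<in> verts G} \<union> edges G"

definition adjacent :: "'a graph \<Rightarrow> 'a \<Rightarrow> 'a \<Rightarrow> bool" where
  "adjacent G u v \<longleftrightarrow> {u, v} \<in> edges G"

definition reachable :: "'a graph \<Rightarrow> 'a \<Rightarrow> 'a \<Rightarrow> bool" where
  "reachable G u v \<longleftrightarrow> u \<in> verts G \<and> (adjacent G)\<^sup>*\<^sup>* u v"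

definition connected_graph :: "'a graph \<Rightarrow> bool" where
  "connected_graph G \<longleftrightarrow> verts G \<noteq> {} \<and> (\<forall>u\<in>verts G. \<forall>v\<in>verts G. reachable G u v)"

definition is_cycle :: "'a graph \<Rightarrow> 'a list \<Rightarrow> bool" where
  "is_cycle G p \<longleftrightarrow> 3 \<le> length p \<and> distinct p \<and>
     (\<forall>i<length p. adjacent G (p ! i) (p ! (Suc i mod length p)))"

definition is_tree :: "'a graph \<Rightarrow> bool" where
  "is_tree G \<longleftrightarrow> is_graph G \<and> connected_graph G \<and> (\<nexists>p. is_cycle G p)"

definition component :: "'a graph \<Rightarrow> 'a \<Rightarrow> 'a graph" where
  "component G w =
     \<lparr>verts = {x. reachable G w x}, edges = {e \<in> edges G. e \<subseteq> {x. reachable G w x}}\<rparr>"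


section \<open>Discrete Morse functions\<close>

definition weakly_increasing :: "'a graph \<Rightarrow> ('a set \<Rightarrow> real) \<Rightarrow> bool" where
  "weakly_increasing G f \<longleftrightarrow> (\<forall>v\<in>verts G. \<forall>e\<in>edges G. {v} \<subseteq> e \<longrightarrow> f {v} \<le> f e)"

definition discrete_morse :: "'a graph \<Rightarrow> ('a set \<Rightarrow> real) \<Rightarrow> bool" where
  "discrete_morse G f \<longleftrightarrow>
     weakly_increasing G f \<and>
     (\<forall>x. card {\<sigma> \<in> simplices G. f \<sigma> = x} \<le> 2) \<and>
     (\<forall>\<sigma>\<in>simplices G. \<forall>\<tau>\<in>simplices G. f \<sigma> = f \<tau> \<longrightarrow> \<sigma> \<subseteq> \<tau> \<or> \<tau> \<subseteq> \<sigma>)"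

definition critical :: "'a graph \<Rightarrow> ('a set \<Rightarrow> real) \<Rightarrow> 'a set \<Rightarrow> bool" where
  "critical G f \<sigma> \<longleftrightarrow> \<sigma> \<in> simplices G \<and> (\<forall>\<tau>\<in>simplices G. f \<tau> = f \<sigma> \<longrightarrow> \<tau> = \<sigma>)"

definition sublevel :: "'a graph \<Rightarrow> ('a set \<Rightarrow> real) \<Rightarrow> real \<Rightarrow> 'a graph" where
  "sublevel G f a = \<lparr>verts = {v \<in> verts G. f {v} \<le> a}, edges = {e \<in> edges G. f e \<le> a}\<rparr>"

definition precedes_by :: "'a graph \<Rightarrow> ('a set \<Rightarrow> real) \<Rightarrow> real \<Rightarrow> real \<Rightarrow> bool" where
  "precedes_by G f c \<epsilon> \<longleftrightarrow> c - \<epsilon> < c \<and> (\<forall>\<sigma>\<in>simplices G. f \<sigma> < c \<longrightarrow> f \<sigma> < c - \<epsilon>)"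

text \<open>Values of the simplices of the subgraph \<open>H\<close> that are critical in the whole graph \<open>G\<close>;
  criticality is not taken relative to \<open>H\<close>.\<close>

definition critical_values_in :: "'a graph \<Rightarrow> ('a set \<Rightarrow> real) \<Rightarrow> 'a graph \<Rightarrow> real set" where
  "critical_values_in G f H = {f \<sigma> | \<sigma>. \<sigma> \<in> simplices H \<and> critical G f \<sigma>}"

abbreviation critical_values :: "'a graph \<Rightarrow> ('a set \<Rightarrow> real) \<Rightarrow> real set" where
  "critical_values G f \<equiv> critical_values_in G f G"


section \<open>Merge trees\<close>

text \<open>In the library type of binary trees the nodes are the occurrences of \<open>Node\<close>, while
  \<open>\<langle>\<rangle>\<close> marks an absent child; the left or right designation of a child is its position. A
  node without children is thus \<open>\<langle>\<langle>\<rangle>, x, \<langle>\<rangle>\<rangle>\<close>, and \<open>\<langle>\<rangle>\<close> itself, having no root, is not a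
  merge tree.\<close>

fun full_binary :: "'b tree \<Rightarrow> bool" where
  "full_binary \<langle>\<rangle> \<longleftrightarrow> True"
| "full_binary \<langle>l, x, r\<rangle> \<longleftrightarrow> (l = \<langle>\<rangle> \<longleftrightarrow> r = \<langle>\<rangle>) \<and> full_binary l \<and> full_binary r"

definition merge_tree :: "'b tree \<Rightarrow> bool" where
  "merge_tree M \<longleftrightarrow> M \<noteq> \<langle>\<rangle> \<and> full_binary M"

datatype direction = L | R

fun opposite :: "direction \<Rightarrow> direction" where
  "opposite L = R"
| "opposite R = L"

text \<open>\<open>branch d M\<^sub>1 c M\<^sub>2\<close> has \<open>M\<^sub>1\<close> as its child in direction \<open>d\<close> and \<open>M\<^sub>2\<close> as its child in
  the opposite direction.\<close>

fun branch :: "direction \<Rightarrow> 'b tree \<Rightarrow> 'b \<Rightarrow> 'b tree \<Rightarrow> 'b tree" where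
  "branch L M\<^sub>1 c M\<^sub>2 = \<langle>M\<^sub>1, c, M\<^sub>2\<rangle>"
| "branch R M\<^sub>1 c M\<^sub>2 = \<langle>M\<^sub>2, c, M\<^sub>1\<rangle>"

text \<open>\<open>subtree_at T f d c M\<close>: the construction, started at a node with label \<open>c\<close> and direction
  \<open>d\<close>, produces \<open>M\<close>. The labels stored in \<open>M\<close> are the values of \<open>f\<^sub>M\<close>. In the second rule the
  names \<open>u\<close> and \<open>v\<close> of the endpoints are chosen so that \<open>u\<close> lies on the side with the smaller
  minimum.\<close>

inductive subtree_at ::
  "'a graph \<Rightarrow> ('a set \<Rightarrow> real) \<Rightarrow> direction \<Rightarrow> real \<Rightarrow> real tree \<Rightarrow> bool"
  for T :: "'a graph" and f :: "'a set \<Rightarrow> real"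
where
  critical_vertex:
    "subtree_at T f d (f {v}) \<langle>\<langle>\<rangle>, f {v}, \<langle>\<rangle>\<rangle>"
    if "v \<in> verts T" "critical T f {v}"
| critical_edge:
    "subtree_at T f d c (branch d M\<^sub>u c M\<^sub>v)"
    if "{u, v} \<in> edges T" "critical T f {u, v}" "c = f {u, v}"
      and "precedes_by T f c \<epsilon>"
      and "C\<^sub>u = critical_values_in T f (component (sublevel T f (c - \<epsilon>)) u)"
      and "C\<^sub>v = critical_values_in T f (component (sublevel T f (c - \<epsilon>)) v)"
      and "Min C\<^sub>u < Min C\<^sub>v"
      and "subtree_at T f d (Max C\<^sub>u) M\<^sub>u"
      and "subtree_at T f (opposite d) (Max C\<^sub>v) M\<^sub>v"

text \<open>The root carries the largest critical value and has direction \<open>L\<close>. If there is no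
  critical edge, then there is only one critical simplex, a vertex, and the result is a single
  node.\<close>

definition induces :: "'a graph \<Rightarrow> ('a set \<Rightarrow> real) \<Rightarrow> real tree \<Rightarrow> bool" where
  "induces T f M \<longleftrightarrow> subtree_at T f L (Max (critical_values T f)) M"

end

theory Submission
  imports Defs
begin

text \<open>Fix a component \<open>H\<close> of a sublevel graph and let \<open>c\<close> be its largest critical value. Every
  edge of \<open>H\<close> above \<open>c\<close> is paired with one of its endpoints, so the part of \<open>H\<close> above \<open>c\<close> retracts
  along gradient paths and carries no critical simplex. Hence if \<open>c\<close> is attained at a vertex, this
  vertex is the only critical simplex of \<open>H\<close>; if it is attained at an edge \<open>uv\<close>, the other critical
  simplices of \<open>H\<close> are those of the components of \<open>u\<close> and \<open>v\<close> just below \<open>c\<close>. As \<open>T\<close> is acyclic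
  these two components are disjoint, and induction on the number of critical values applies.\<close>

section \<open>Paths and reachability\<close>

text \<open>When the next point already lies on the path, the path is cut at that point; otherwise
  the point is appended.\<close>

lemma rtranclp_imp_distinct_path:
  assumes "r\<^sup>*\<^sup>* x y"
  shows "\<exists>p. p \<noteq> [] \<and> hd p = x \<and> last p = y \<and> distinct p \<and> successively r p"
  using assms
proof (induction rule: rtranclp_induct)
  case base
  show ?case by (rule exI[of _ "[x]"]) simp
next
  case (step y z)
  then obtain p where p: "p \<noteq> []" "hd p = x" "last p = y" "distinct p" "successively r p"
    by blast
  show ?case
  proof (cases "z \<in> set p")
    case True
    then obtain q s where "p = q @ z # s" by (meson split_list)
    then have "p = (q @ [z]) @ s" by simp
    with p have "distinct (q @ [z])" "successively r (q @ [z])" "hd (q @ [z]) = x"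
      by (auto simp: successively_append_iff hd_append split: if_splits)
    then show ?thesis by (intro exI[of _ "q @ [z]"]) simp
  next
    case False
    with p step show ?thesis
      by (intro exI[of _ "p @ [z]"]) (auto simp: successively_append_iff)
  qed
qed

text \<open>A simple path from \<open>u\<close> to \<open>v\<close> that avoids the edge
  \<open>uv\<close> closes up with this edge to a cycle.\<close>

lemma bypassed_edge_imp_cycle:
  assumes uv: "{u, v} \<in> edges G" "u \<noteq> v"
    and path: "(\<lambda>x y. {x, y} \<in> edges G \<and> {x, y} \<noteq> {u, v})\<^sup>*\<^sup>* u v"
  shows "\<exists>p. is_cycle G p"
proof -
  let ?r = "\<lambda>x y. {x, y} \<in> edges G \<and> {x, y} \<noteq> {u, v}"
  obtain p where p: "p \<noteq> []" "hd p = u" "last p = v" "distinct p" "successively ?r p"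
    using rtranclp_imp_distinct_path[OF path] by blast
  obtain q where q: "p = u # q" using p by (cases p) auto
  have "q \<noteq> []" using q p uv by auto
  then obtain y q' where q': "q = y # q'" by (cases q) auto
  \<comment> \<open>A path of two vertices would run through the excluded edge, so the cycle has at
    least three vertices.\<close>
  have "q' \<noteq> []" using q q' p by auto
  then have len: "3 \<le> length p" using q q' by (cases q') auto
  have "adjacent G (p ! i) (p ! (Suc i mod length p))" if i: "i < length p" for i
  proof (cases "Suc i < length p")
    case True
    then show ?thesis
      using successively_nth[OF p(5) True] by (simp add: adjacent_def)
  next
    case False
    then have "Suc i = length p" using i by linarith
  then have "i = length p - 1" "Suc i mod length p = 0" by auto
    then show ?thesis
      using p uv by (simp add: adjacent_def last_conv_nth hd_conv_nth insert_commute)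
  qed
  then show ?thesis using len p unfolding is_cycle_def by blast
qed

lemma adjacent_sym: "adjacent G x y \<Longrightarrow> adjacent G y x"
  by (simp add: adjacent_def insert_commute)

lemma adjacent_rtranclp_sym: "(adjacent G)\<^sup>*\<^sup>* x y \<Longrightarrow> (adjacent G)\<^sup>*\<^sup>* y x"
  by (metis adjacent_sym sympI sympD symp_rtranclp)

lemma component_eq:
  assumes "reachable G w v" "v \<in> verts G"
  shows "component G w = component G v"
proof -
  have "reachable G w x \<longleftrightarrow> reachable G v x" for x
    using assms unfolding reachable_def
    by (meson adjacent_rtranclp_sym rtranclp_trans)
  then show ?thesis by (simp add: component_def)
qed

lemma reachable_refl: "w \<in> verts G \<Longrightarrow> reachable G w w"
  by (simp add: reachable_def)

lemma reachable_step: "reachable G w x \<Longrightarrow> {x, y} \<in> edges G \<Longrightarrow> reachable G w y"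
  unfolding reachable_def adjacent_def by (metis (no_types, lifting) rtranclp.rtrancl_into_rtrancl)

lemma reachable_mono:
  assumes "reachable G w x" "verts G \<subseteq> verts H" "edges G \<subseteq> edges H"
  shows "reachable H w x"
proof -
  have "adjacent G \<le> adjacent H" using assms(3) by (auto simp: adjacent_def)
  then have "(adjacent G)\<^sup>*\<^sup>* \<le> (adjacent H)\<^sup>*\<^sup>*" by (rule rtranclp_mono)
  then show ?thesis using assms by (auto simp: reachable_def)
qed


section \<open>Critical simplices of components\<close>

locale morse_graph =
  fixes T :: "'a graph" and f :: "'a set \<Rightarrow> real"
  assumes graph: "is_graph T" and morse: "discrete_morse T f"
begin

lemma edge_verts: "{x, y} \<in> edges T \<Longrightarrow> x \<in> verts T \<and> y \<in> verts T \<and> x \<noteq> y"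
  using graph by (fastforce simp: is_graph_def)

lemma edge_cases:
  assumes "e \<in> edges T"
  obtains x y where "e = {x, y}" "x \<noteq> y"
proof -
  have "card e = 2" using assms graph by (simp add: is_graph_def)
  then show ?thesis using that by (auto simp: card_2_iff)
qed

lemma simplex_cases:
  assumes "\<sigma> \<in> simplices T"
  obtains (vertex) x where "\<sigma> = {x}" "x \<in> verts T"
    | (edge) x y where "\<sigma> = {x, y}" "x \<noteq> y" "{x, y} \<in> edges T"
proof (cases "\<sigma> \<in> edges T")
  case True
  then show ?thesis using edge_cases[OF True] edge by metis
next
  case False
  then show ?thesis using assms vertex by (auto simp: simplices_def)
qed

lemma simplices_intros:
  "x \<in> verts T \<Longrightarrow> {x} \<in> simplices T" "e \<in> edges T \<Longrightarrow> e \<in> simplices T"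
  by (auto simp: simplices_def)

lemma finite_simplices: "finite (simplices T)"
proof -
  have "simplices T \<subseteq> Pow (verts T)"
    using graph by (auto simp: simplices_def is_graph_def)
  moreover have "finite (Pow (verts T))" using graph by (simp add: is_graph_def)
  ultimately show ?thesis by (rule finite_subset)
qed

section \<open>Pairing of simplices of equal value\<close>

lemma face_le: "{x, y} \<in> edges T \<Longrightarrow> f {x} \<le> f {x, y}"
  using morse edge_verts[of x y] by (simp add: discrete_morse_def weakly_increasing_def)

lemma eq_imp_comparable:
  "\<sigma> \<in> simplices T \<Longrightarrow> \<tau> \<in> simplices T \<Longrightarrow> f \<sigma> = f \<tau> \<Longrightarrow> \<sigma> \<subseteq> \<tau> \<or> \<tau> \<subseteq> \<sigma>"
  using morse by (simp add: discrete_morse_def)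

text \<open>Two edges have the same cardinality, so comparability forces equality.\<close>

lemma edge_value_inj:
  assumes "e \<in> edges T" "e' \<in> edges T" "f e = f e'"
  shows "e = e'"
proof -
  have "card e = 2" "card e' = 2" "finite e" "finite e'"
    using assms graph by (auto simp: is_graph_def card_ge_0_finite)
  moreover have "e \<subseteq> e' \<or> e' \<subseteq> e"
    using eq_imp_comparable assms simplices_intros(2) by blast
  ultimately show ?thesis by (metis card_subset_eq)
qed

lemma vertex_value_inj: "x \<in> verts T \<Longrightarrow> y \<in> verts T \<Longrightarrow> f {x} = f {y} \<Longrightarrow> x = y"
  using eq_imp_comparable[of "{x}" "{y}"] simplices_intros(1) by auto

text \<open>A second simplex with the value of the edge is comparable to it and, by
  \<open>edge_value_inj\<close>, not an edge; hence it is an endpoint. Together with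
  \<open>noncritical_vertex\<close> this is the pairing of the discrete gradient.\<close>

lemma noncritical_edge:
  assumes "{x, y} \<in> edges T" "\<not> critical T f {x, y}"
  shows "f {x} = f {x, y} \<or> f {y} = f {x, y}"
proof -
  obtain \<tau> where \<tau>: "\<tau> \<in> simplices T" "f \<tau> = f {x, y}" "\<tau> \<noteq> {x, y}"
    using assms simplices_intros unfolding critical_def by blast
  from \<tau>(1) show ?thesis
  proof (cases rule: simplex_cases)
    case (vertex z)
    then have "z \<in> {x, y}"
      using eq_imp_comparable[of "{z}" "{x, y}"] \<tau> assms(1) edge_verts simplices_intros
      by fastforce
    then show ?thesis using \<tau> vertex by auto
  next
    case (edge a b)
    then show ?thesis using edge_value_inj assms(1) \<tau> by metis
  qed
qed

lemma noncritical_vertex: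
  assumes "x \<in> verts T" "\<not> critical T f {x}"
  obtains y where "{x, y} \<in> edges T" "f {x, y} = f {x}"
proof -
  obtain \<tau> where \<tau>: "\<tau> \<in> simplices T" "f \<tau> = f {x}" "\<tau> \<noteq> {x}"
    using assms simplices_intros unfolding critical_def by blast
  from \<tau>(1) show ?thesis
  proof (cases rule: simplex_cases)
    case (vertex z)
    then show ?thesis using \<tau> vertex_value_inj assms(1) by metis
  next
    case (edge a b)
    have "x \<in> {a, b}"
      using eq_imp_comparable[of \<tau> "{x}"] \<tau> assms(1) edge simplices_intros by auto
    then show ?thesis using that \<tau> edge by (metis insertE insert_commute singletonD)
  qed
qed

lemma critical_inj: "critical T f \<sigma> \<Longrightarrow> critical T f \<tau> \<Longrightarrow> f \<sigma> = f \<tau> \<Longrightarrow> \<sigma> = \<tau>"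
  unfolding critical_def by metis

lemma critical_nonempty: "critical T f \<sigma> \<Longrightarrow> \<sigma> \<noteq> {}"
  using simplex_cases[of \<sigma>] by (auto simp: critical_def)

text \<open>Equality would give the critical one of the two simplices a second simplex of the same
  value.\<close>

lemma critical_face_less:
  assumes "{x, y} \<in> edges T" "critical T f {x} \<or> critical T f {x, y}"
  shows "f {x} < f {x, y}"
proof -
  have "{x} \<noteq> {x, y}" using edge_verts[OF assms(1)] by auto
  then have "f {x} \<noteq> f {x, y}"
    using assms edge_verts[OF assms(1)] simplices_intros unfolding critical_def by metis
  then show ?thesis using face_le[OF assms(1)] by simp
qed

text \<open>A vertex entered through the edge it is paired with can be left only back along that edge or
  through an edge of larger value, which, if not critical, is paired with its far endpoint. So
  without critical edges above \<open>c\<close>, \<open>flow S c\<close> exhausts the component.\<close>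

inductive flow :: "'a set \<Rightarrow> real \<Rightarrow> 'a \<Rightarrow> bool" for S c where
  start: "x \<in> S \<Longrightarrow> flow S c x"
| ascend: "flow S c x \<Longrightarrow> {x, y} \<in> edges T \<Longrightarrow> f {y} = f {x, y} \<Longrightarrow> c < f {y} \<Longrightarrow> flow S c y"

text \<open>A vertex outside \<open>S\<close> enters the flow only through an edge of its own value,
  which is above \<open>c\<close>.\<close>

lemma flow_noncritical:
  assumes "flow S c x"
  shows "x \<in> S \<or> c < f {x} \<and> \<not> critical T f {x}"
  using assms
proof cases
  case (ascend y)
  then show ?thesis using critical_face_less[of x y] by (auto simp: insert_commute)
qed simp

section \<open>Vertex sets of sublevel components\<close>

definition comp_verts :: "real \<Rightarrow> 'a \<Rightarrow> 'a set" where
  "comp_verts a w = {x. reachable (sublevel T f a) w x}"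

text \<open>\<open>reachable\<close> puts only the starting vertex into the sublevel graph; every
  later vertex is an endpoint of an edge of value at most \<open>a\<close>, and
  \<open>face_le\<close> bounds it.\<close>

lemma comp_verts_sublevel:
  assumes "x \<in> comp_verts a w"
  shows "x \<in> verts T \<and> f {x} \<le> a"
proof -
  have "(adjacent (sublevel T f a))\<^sup>*\<^sup>* w x" "w \<in> verts T \<and> f {w} \<le> a"
    using assms by (auto simp: comp_verts_def reachable_def sublevel_def)
  then show ?thesis
  proof (induction rule: rtranclp_induct)
    case (step y z)
    then have "{z, y} \<in> edges T" "f {z, y} \<le> a"
      by (auto simp: adjacent_def sublevel_def insert_commute)
    then show ?case using edge_verts face_le by fastforce
  qed
qed

lemma comp_verts_refl: "w \<in> verts T \<Longrightarrow> f {w} \<le> a \<Longrightarrow> w \<in> comp_verts a w"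
  by (simp add: comp_verts_def reachable_def sublevel_def)

lemma comp_verts_step:
  "x \<in> comp_verts a w \<Longrightarrow> {x, y} \<in> edges T \<Longrightarrow> f {x, y} \<le> a \<Longrightarrow> y \<in> comp_verts a w"
  unfolding comp_verts_def by (auto simp: sublevel_def elim!: reachable_step)

lemma comp_verts_mono:
  "a \<le> b \<Longrightarrow> comp_verts a w \<subseteq> comp_verts b w"
  by (auto simp: comp_verts_def sublevel_def elim!: reachable_mono)

lemma comp_verts_induct [consumes 1, case_names base step]:
  assumes "x \<in> comp_verts a w"
    and base: "P w"
    and step: "\<And>x y. x \<in> comp_verts a w \<Longrightarrow> P x \<Longrightarrow> {x, y} \<in> edges T \<Longrightarrow> f {x, y} \<le> a \<Longrightarrow> P y"
  shows "P x"
proof -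
  have "(adjacent (sublevel T f a))\<^sup>*\<^sup>* w x" "w \<in> verts (sublevel T f a)"
    using assms by (auto simp: comp_verts_def reachable_def)
  then have "x \<in> comp_verts a w \<and> P x"
  proof (induction rule: rtranclp_induct)
    case base
    then show ?case using assms(2) by (simp add: comp_verts_def reachable_refl)
  next
    case (step y z)
    then have "{y, z} \<in> edges T" "f {y, z} \<le> a"
      by (auto simp: adjacent_def sublevel_def)
    then show ?case using step assms(3) comp_verts_step by blast
  qed
  then show ?thesis ..
qed

lemma comp_verts_eq:
  assumes "v \<in> comp_verts a w"
  shows "component (sublevel T f a) w = component (sublevel T f a) v"
proof (rule component_eq)
  show "reachable (sublevel T f a) w v" using assms by (simp add: comp_verts_def)
  show "v \<in> verts (sublevel T f a)"
    using comp_verts_sublevel[OF assms] by (simp add: sublevel_def)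
qed

text \<open>The retraction argument, applied below to \<open>S = {v}\<close> and to a union of two
  components. The flow from \<open>S\<close> reaches the whole component, and outside
  \<open>S\<close> it meets only noncritical vertices of value above \<open>c\<close>, which cannot
  be ends of an edge of value at most \<open>c\<close>.\<close>

lemma critical_subset_core:
  assumes "w \<in> S"
    and low: "\<And>x. x \<in> S \<Longrightarrow> f {x} \<le> c"
    and closed: "\<And>x y. x \<in> S \<Longrightarrow> {x, y} \<in> edges T \<Longrightarrow> f {x, y} \<le> c \<Longrightarrow> y \<in> S"
    and bound: "\<And>\<sigma>. critical T f \<sigma> \<Longrightarrow> \<sigma> \<subseteq> comp_verts a w \<Longrightarrow> f \<sigma> \<le> a \<Longrightarrow> f \<sigma> \<le> c"
    and \<sigma>: "critical T f \<sigma>" "\<sigma> \<subseteq> comp_verts a w" "f \<sigma> \<le> a"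
  shows "\<sigma> \<subseteq> S"
proof -
  have flow: "flow S c x" if "x \<in> comp_verts a w" for x
    using that
  proof (induction rule: comp_verts_induct)
    case base
    then show ?case using assms(1) by (rule start)
  next
    case (step x y)
    have x: "x \<in> comp_verts a w" and ih: "flow S c x"
      and xy: "{x, y} \<in> edges T" "f {x, y} \<le> a" by fact+
    have up: "f {x} = f {x, y} \<or> f {y} = f {x, y}" if "c < f {x, y}"
    proof (rule noncritical_edge[OF xy(1)])
      have "{x, y} \<subseteq> comp_verts a w" using comp_verts_step x xy by simp
      then show "\<not> critical T f {x, y}" using bound xy(2) that by force
    qed
    have "f {y} = f {x, y} \<Longrightarrow> c < f {x, y} \<Longrightarrow> flow S c y"
      using ascend[OF ih xy(1)] by simp
    moreover have "f {x} \<le> f {x, y}" using face_le xy(1) by blast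
    \<comment> \<open>The edge is paired with \<open>x\<close>. Since \<open>f {x}\<close> exceeds
      \<open>c\<close>, the vertex \<open>x\<close> is not in \<open>S\<close> and was entered along
      an edge of the same value, hence along this very edge; so \<open>y\<close> is its
      predecessor.\<close>
    moreover from ih have "flow S c y" if "f {x} = f {x, y}" "c < f {x, y}"
    proof cases
      case start
      then show ?thesis using low that by fastforce
    next
      case (ascend z)
      then have "{z, x} = {x, y}" using edge_value_inj xy(1) that by metis
      then have "z = y" by (auto simp: doubleton_eq_iff)
      then show ?thesis using ascend by simp
    qed
    \<comment> \<open>Vertices reached by ascending lie above \<open>c\<close>, so here
      \<open>x\<close> belongs to \<open>S\<close> and \<open>closed\<close> applies.\<close>
    moreover from ih have "flow S c y" if "f {x, y} \<le> c"
    proof cases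
      case start
      then show ?thesis using closed[OF _ xy(1) that] flow.start by blast
    next
      case (ascend z)
      then show ?thesis using that face_le[OF xy(1)] by linarith
    qed
    ultimately show ?case using up by force
  qed
  have \<sigma>c: "f \<sigma> \<le> c" using bound \<sigma> by blast
  have "\<sigma> \<in> simplices T" using \<sigma>(1) by (simp add: critical_def)
  then show ?thesis
  proof (cases rule: simplex_cases)
    case (vertex x)
    then show ?thesis using flow_noncritical[OF flow[of x]] \<sigma> by auto
  next
    case (edge x y)
    then have "f {x} \<le> c" "f {y} \<le> c"
      using face_le[of x y] face_le[of y x] \<sigma>c by (auto simp: insert_commute)
    then show ?thesis
      using flow_noncritical[OF flow[of x]] flow_noncritical[OF flow[of y]] \<sigma> edge by auto
  qed
qed

section \<open>Critical values of sublevel components\<close>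

abbreviation comp_crits :: "real \<Rightarrow> 'a \<Rightarrow> real set" where
  "comp_crits a w \<equiv> critical_values_in T f (component (sublevel T f a) w)"

text \<open>For a vertex the bound \<open>f \<sigma> \<le> a\<close> follows from membership; an
  edge between two vertices of the component may lie above \<open>a\<close>.\<close>

lemma comp_crits_eq:
  "comp_crits a w = {f \<sigma> | \<sigma>. critical T f \<sigma> \<and> \<sigma> \<subseteq> comp_verts a w \<and> f \<sigma> \<le> a}"
proof -
  have "\<sigma> \<in> simplices (component (sublevel T f a) w) \<longleftrightarrow> \<sigma> \<subseteq> comp_verts a w \<and> f \<sigma> \<le> a"
    if "\<sigma> \<in> simplices T" for \<sigma>
  proof -
    have "\<sigma> \<in> simplices (component (sublevel T f a) w) \<longleftrightarrow>
        (\<exists>x\<in>comp_verts a w. \<sigma> = {x}) \<or> \<sigma> \<in> edges T \<and> f \<sigma> \<le> a \<and> \<sigma> \<subseteq> comp_verts a w"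
      by (auto simp: simplices_def component_def comp_verts_def sublevel_def)
    then show ?thesis using that comp_verts_sublevel by (auto simp: simplices_def)
  qed
  then show ?thesis unfolding critical_values_in_def critical_def by blast
qed

lemma comp_critsI:
  "critical T f \<sigma> \<Longrightarrow> \<sigma> \<subseteq> comp_verts a w \<Longrightarrow> f \<sigma> \<le> a \<Longrightarrow> f \<sigma> \<in> comp_crits a w"
  unfolding comp_crits_eq by blast

lemma finite_comp_crits: "finite (comp_crits a w)"
proof -
  have "comp_crits a w \<subseteq> f ` simplices T" unfolding comp_crits_eq critical_def by auto
  then show ?thesis using finite_simplices finite_surj by blast
qed

text \<open>A vertex \<open>m\<close> of least value in the component is critical: an edge
  \<open>my\<close> of value \<open>f {m}\<close> would keep \<open>y\<close> in the component and
  force \<open>f {y} = f {m}\<close>, against \<open>vertex_value_inj\<close>.\<close>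

lemma comp_crits_nonempty:
  assumes "w \<in> verts T" "f {w} \<le> a"
  shows "comp_crits a w \<noteq> {}"
proof -
  let ?R = "comp_verts a w"
  have "?R \<subseteq> verts T" using comp_verts_sublevel by blast
  then have "finite ?R" using graph finite_subset by (auto simp: is_graph_def)
  moreover have "?R \<noteq> {}" using comp_verts_refl assms by blast
  ultimately obtain m where m: "m \<in> ?R" "\<And>x. x \<in> ?R \<Longrightarrow> f {m} \<le> f {x}"
    using ex_min_if_finite[of "(\<lambda>x. f {x}) ` ?R"] by fastforce
  have mT: "m \<in> verts T" "f {m} \<le> a" using comp_verts_sublevel m by auto
  have "critical T f {m}"
  proof (rule ccontr)
    assume "\<not> critical T f {m}"
    then obtain y where y: "{m, y} \<in> edges T" "f {m, y} = f {m}"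
      using noncritical_vertex mT by blast
    then have "f {m} \<le> f {y}" using m comp_verts_step mT by simp
    moreover have "f {y} \<le> f {m}" using face_le[of y m] y by (simp add: insert_commute)
    ultimately show False using vertex_value_inj[of m y] edge_verts[OF y(1)] by auto
  qed
  then show ?thesis unfolding comp_crits_eq using m mT by blast
qed


section \<open>The merge tree of a component\<close>

text \<open>No value is at least \<open>c - \<epsilon>\<close> and less than \<open>c\<close>, so
  the sublevel graph at \<open>c - \<epsilon>\<close> is the strict sublevel graph at
  \<open>c\<close>.\<close>

lemma precedes_by_iff:
  assumes "precedes_by T f c \<epsilon>" "\<sigma> \<in> simplices T"
  shows "f \<sigma> \<le> c - \<epsilon> \<longleftrightarrow> f \<sigma> < c"
  using assms unfolding precedes_by_def by force

text \<open>Makes the construction independent of the choice of \<open>\<epsilon>\<close>, as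
  uniqueness requires.\<close>

lemma precedes_by_sublevel_eq:
  assumes "precedes_by T f c \<epsilon>" "precedes_by T f c \<epsilon>'"
  shows "sublevel T f (c - \<epsilon>) = sublevel T f (c - \<epsilon>')"
  unfolding sublevel_def
  using precedes_by_iff[OF assms(1)] precedes_by_iff[OF assms(2)] simplices_intros by auto

lemma ex_precedes_by: "\<exists>\<epsilon>. precedes_by T f c \<epsilon>"
proof -
  \<comment> \<open>The element \<open>c - 1\<close> keeps the set nonempty when no simplex lies
    below \<open>c\<close>; half the gap between \<open>c\<close> and the maximum then serves as
    \<open>\<epsilon>\<close>.\<close>
  let ?A = "insert (c - 1) {f \<sigma> | \<sigma>. \<sigma> \<in> simplices T \<and> f \<sigma> < c}"
  have fin: "finite ?A" using finite_simplices by auto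
  then have "Max ?A < c" by (subst Max_less_iff) auto
  moreover have "f \<sigma> \<le> Max ?A" if "\<sigma> \<in> simplices T" "f \<sigma> < c" for \<sigma>
    using that fin by (intro Max_ge) auto
  ultimately show ?thesis
    unfolding precedes_by_def by (intro exI[of _ "(c - Max ?A) / 2"]) (fastforce simp: field_simps)
qed

text \<open>A label determines its critical simplex, since \<open>f\<close> is injective on critical
  simplices, and the simplex determines the rule that applies.\<close>

lemma subtree_at_unique:
  assumes "subtree_at T f d c M" "subtree_at T f d c M'"
  shows "M = M'"
  using assms
proof (induction arbitrary: M' rule: subtree_at.induct)
  case (critical_vertex v d)
  from critical_vertex(3) show ?case
  proof cases
    case (critical_edge u w)
    then have "{v} = {u, w}" using critical_vertex(2) critical_inj by metis
    then show ?thesis using critical_edge edge_verts by (metis doubleton_eq_iff insert_absorb2)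
  qed auto
next
  case (critical_edge u v c \<epsilon> Cu Cv d Mu Mv)
  from critical_edge.prems show ?case
  proof cases
    case (critical_vertex w)
    then have "{w} = {u, v}" using critical_edge.hyps critical_inj by metis
    then show ?thesis using critical_edge.hyps edge_verts by (metis doubleton_eq_iff insert_absorb2)
  next
    case (critical_edge u' v' \<epsilon>' Cu' Cv' Mu' Mv')
    note new = critical_edge
    have eq: "{u, v} = {u', v'}" using new critical_edge.hyps critical_inj by metis
    have sub: "sublevel T f (c - \<epsilon>) = sublevel T f (c - \<epsilon>')"
      using precedes_by_sublevel_eq new critical_edge.hyps by blast
    from eq consider "u = u'" "v = v'" | "u = v'" "v = u'" by (auto simp: doubleton_eq_iff)
    then show ?thesis
    proof cases
      case 1
      then have "Cu = Cu'" "Cv = Cv'" using new critical_edge.hyps sub by simp_all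
      then show ?thesis using new critical_edge.IH by simp
    next
      \<comment> \<open>Swapped endpoints would give both strict inequalities between the two
        minima.\<close>
      case 2
      then have "Cu = Cv'" "Cv = Cu'" using new critical_edge.hyps sub by simp_all
      then show ?thesis using new critical_edge.hyps by simp
    qed
  qed
qed

text \<open>\<open>critical_subset_core\<close> with \<open>S = {v}\<close>, which is closed because
  every edge at a critical vertex \<open>v\<close> has value above \<open>f {v}\<close>.\<close>

lemma comp_crits_vertex:
  assumes "critical T f {v}" "v \<in> verts T" "f {v} \<le> a"
    and "\<And>x. x \<in> comp_crits a v \<Longrightarrow> x \<le> f {v}"
  shows "comp_crits a v = {f {v}}"
proof -
  have "\<sigma> = {v}" if "critical T f \<sigma>" "\<sigma> \<subseteq> comp_verts a v" "f \<sigma> \<le> a" for \<sigma>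
  proof -
    have "\<sigma> \<subseteq> {v}"
    proof (rule critical_subset_core[where w = v and a = a and c = "f {v}"])
      fix x y assume "x \<in> {v}" "{x, y} \<in> edges T" "f {x, y} \<le> f {v}"
      then show "y \<in> {v}" using critical_face_less[of v y] assms(1) by auto
    next
      fix \<tau> assume "critical T f \<tau>" "\<tau> \<subseteq> comp_verts a v" "f \<tau> \<le> a"
      then show "f \<tau> \<le> f {v}" using assms(4) comp_critsI by blast
    qed (use that in auto)
    then show ?thesis using critical_nonempty[OF that(1)] by blast
  qed
  moreover have "f {v} \<in> comp_crits a v"
    using assms(1-3) comp_verts_refl by (intro comp_critsI) auto
  ultimately show ?thesis unfolding comp_crits_eq by blast
qed

lemma critical_edge_ends_below:
  assumes "{u, v} \<in> edges T" "critical T f {u, v}" "precedes_by T f (f {u, v}) \<epsilon>"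
  shows "u \<in> verts T" "v \<in> verts T"
    "f {u} \<le> f {u, v} - \<epsilon>" "f {v} \<le> f {u, v} - \<epsilon>"
proof -
  show uv: "u \<in> verts T" "v \<in> verts T" using edge_verts[OF assms(1)] by auto
  have "f {u} < f {u, v}" "f {v} < f {u, v}"
    using critical_face_less[of u v] critical_face_less[of v u] assms(1,2)
    by (simp_all add: insert_commute)
  then show "f {u} \<le> f {u, v} - \<epsilon>" "f {v} \<le> f {u, v} - \<epsilon>"
    using precedes_by_iff[OF assms(3)] simplices_intros(1) uv by auto
qed

text \<open>\<open>critical_subset_core\<close> with \<open>S\<close> the union of the components of
  \<open>u\<close> and \<open>v\<close> just below the edge. It is closed because the only edge of
  value \<open>f {u, v}\<close> is \<open>uv\<close>, whose ends both lie in
  \<open>S\<close>.\<close>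

lemma comp_crits_edge:
  assumes uv: "{u, v} \<in> edges T" "critical T f {u, v}" "f {u, v} \<le> a"
    and max: "\<And>x. x \<in> comp_crits a u \<Longrightarrow> x \<le> f {u, v}"
    and \<epsilon>: "precedes_by T f (f {u, v}) \<epsilon>"
  shows "comp_crits a u =
    insert (f {u, v}) (comp_crits (f {u, v} - \<epsilon>) u \<union> comp_crits (f {u, v} - \<epsilon>) v)"
    (is "_ = insert ?c (comp_crits ?b u \<union> comp_crits ?b v)")
proof -
  let ?U = "comp_verts ?b u" and ?V = "comp_verts ?b v"
  have below: "f \<sigma> \<le> ?b \<longleftrightarrow> f \<sigma> < ?c" if "\<sigma> \<in> simplices T" for \<sigma>
    using precedes_by_iff \<epsilon> that by blast
  note ends = critical_edge_ends_below[OF uv(1,2) \<epsilon>]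
  have base: "u \<in> ?U" "v \<in> ?V" using ends comp_verts_refl by auto
  have ba: "?b \<le> a" using \<epsilon> uv(3) by (simp add: precedes_by_def)
  have "f {u} \<le> a" using comp_verts_sublevel[OF base(1)] ba by simp
  then have ua: "u \<in> comp_verts a u" using comp_verts_refl ends by blast
  then have va: "v \<in> comp_verts a u" using comp_verts_step uv by blast
  have comp: "comp_verts a v = comp_verts a u"
    using comp_verts_eq[OF va] by (simp add: component_def comp_verts_def)
  have sub: "?U \<subseteq> comp_verts a u" "?V \<subseteq> comp_verts a u"
    using comp_verts_mono[OF ba, of u] comp_verts_mono[OF ba, of v] comp by auto
  have core: "\<sigma> \<subseteq> ?U \<union> ?V" if "critical T f \<sigma>" "\<sigma> \<subseteq> comp_verts a u" "f \<sigma> \<le> a" for \<sigma>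
  proof (rule critical_subset_core[where w = u and a = a and c = ?c])
    fix x assume "x \<in> ?U \<union> ?V"
    then show "f {x} \<le> ?c" using comp_verts_sublevel \<epsilon> by (fastforce simp: precedes_by_def)
  next
    fix x y assume x: "x \<in> ?U \<union> ?V" and xy: "{x, y} \<in> edges T" "f {x, y} \<le> ?c"
    show "y \<in> ?U \<union> ?V"
    proof (cases "f {x, y} = ?c")
      case True
      then have "{x, y} = {u, v}" using edge_value_inj xy uv by blast
      then show ?thesis using base by (auto simp: doubleton_eq_iff)
    next
      case False
      then have "f {x, y} \<le> ?b" using below xy simplices_intros by force
      then show ?thesis using comp_verts_step x xy by blast
    qed
  next
    fix \<tau> assume "critical T f \<tau>" "\<tau> \<subseteq> comp_verts a u" "f \<tau> \<le> a"
    then show "f \<tau> \<le> ?c" using max comp_critsI by blast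
  qed (use base that in auto)
  have "f \<sigma> \<in> comp_crits ?b u \<union> comp_crits ?b v"
    if \<sigma>: "critical T f \<sigma>" "\<sigma> \<subseteq> comp_verts a u" "f \<sigma> \<le> a" "f \<sigma> \<noteq> ?c" for \<sigma>
  proof -
    have simp: "\<sigma> \<in> simplices T" using \<sigma> by (simp add: critical_def)
    have "f \<sigma> \<le> ?c" using max comp_critsI[OF \<sigma>(1-3)] by blast
    then have b: "f \<sigma> \<le> ?b" using below simp \<sigma> by force
    from simp have "\<sigma> \<subseteq> ?U \<or> \<sigma> \<subseteq> ?V"
    proof (cases rule: simplex_cases)
      case (vertex x)
      then show ?thesis using core[OF \<sigma>(1-3)] by auto
    next
      \<comment> \<open>\<open>core\<close> only puts the edge into the union; its value, at most
        \<open>?b\<close>, forces both ends into the same component.\<close>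
      case (edge x y)
      then show ?thesis using core[OF \<sigma>(1-3)] b comp_verts_step[of x _ _ y] by auto
    qed
    then show ?thesis using comp_critsI[OF \<sigma>(1) _ b] by blast
  qed
  moreover have "?c \<in> comp_crits a u" using uv ua va by (intro comp_critsI) auto
  moreover have "comp_crits ?b u \<union> comp_crits ?b v \<subseteq> comp_crits a u"
    using sub order_trans[OF _ ba] unfolding comp_crits_eq by blast
  ultimately show ?thesis unfolding comp_crits_eq[of a u] by blast
qed

text \<open>Here acyclicity enters. A common value belongs to one critical simplex, whose vertices
  are joined to both \<open>u\<close> and \<open>v\<close> at level \<open>b\<close>. The resulting
  walk from \<open>u\<close> to \<open>v\<close> avoids the edge \<open>uv\<close>, whose value
  exceeds \<open>b\<close>, and yields a cycle.\<close>

lemma comp_crits_disjoint: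
  assumes uv: "{u, v} \<in> edges T" and acyclic: "\<nexists>p. is_cycle T p" and b: "b < f {u, v}"
  shows "comp_crits b u \<inter> comp_crits b v = {}"
proof (rule ccontr)
  assume "comp_crits b u \<inter> comp_crits b v \<noteq> {}"
  then obtain r where r: "r \<in> comp_crits b u" "r \<in> comp_crits b v" by blast
  obtain \<sigma> where \<sigma>: "critical T f \<sigma>" "\<sigma> \<subseteq> comp_verts b u" "f \<sigma> = r"
    using r(1) unfolding comp_crits_eq by blast
  obtain \<tau> where \<tau>: "critical T f \<tau>" "\<tau> \<subseteq> comp_verts b v" "f \<tau> = r"
    using r(2) unfolding comp_crits_eq by blast
  have "\<sigma> = \<tau>" using critical_inj \<sigma> \<tau> by metis
  obtain x where "x \<in> \<sigma>" using critical_nonempty[OF \<sigma>(1)] by blast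
  with \<open>\<sigma> = \<tau>\<close> have "reachable (sublevel T f b) u x" "reachable (sublevel T f b) v x"
    using \<sigma>(2) \<tau>(2) by (auto simp: comp_verts_def)
  then have "(adjacent (sublevel T f b))\<^sup>*\<^sup>* u x" "(adjacent (sublevel T f b))\<^sup>*\<^sup>* x v"
    by (auto simp: reachable_def intro: adjacent_rtranclp_sym)
  then have "(adjacent (sublevel T f b))\<^sup>*\<^sup>* u v" by (rule rtranclp_trans)
  moreover have "{x, y} \<in> edges T \<and> {x, y} \<noteq> {u, v}" if "adjacent (sublevel T f b) x y" for x y
    using that b by (auto simp: adjacent_def sublevel_def simp del: doubleton_eq_iff)
  ultimately have "(\<lambda>x y. {x, y} \<in> edges T \<and> {x, y} \<noteq> {u, v})\<^sup>*\<^sup>* u v"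
    by (rule mono_rtranclp[rule_format, rotated])
  then have "\<exists>p. is_cycle T p"
    using bypassed_edge_imp_cycle[OF uv] edge_verts[OF uv] by simp
  with acyclic show False ..
qed

text \<open>Lets the induction treat both directions uniformly.\<close>

lemma branch_simps:
  "full_binary (branch d M c M') \<longleftrightarrow>
    (M = \<langle>\<rangle> \<longleftrightarrow> M' = \<langle>\<rangle>) \<and> full_binary M \<and> full_binary M'"
  "set_tree (branch d M c M') = insert c (set_tree M \<union> set_tree M')"
  "distinct (inorder (branch d M c M')) \<longleftrightarrow> distinct (inorder M) \<and> distinct (inorder M') \<and>
    c \<notin> set_tree M \<and> c \<notin> set_tree M' \<and> set_tree M \<inter> set_tree M' = {}"
  "branch d M c M' \<noteq> \<langle>\<rangle>"
  by (cases d; auto)+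

text \<open>Induction on the number of critical values; \<open>a\<close>, \<open>w\<close> and
  \<open>d\<close> vary because the children start at a lower level, at the two ends of the edge and
  in opposite directions. The label set is carried along so that disjoint critical values of the two
  sides give distinct labels.\<close>

lemma ex_subtree_at:
  assumes "\<nexists>p. is_cycle T p" "w \<in> verts T" "f {w} \<le> a"
  shows "\<exists>M. subtree_at T f d (Max (comp_crits a w)) M \<and> merge_tree M \<and>
    distinct (inorder M) \<and> set_tree M = comp_crits a w"
  using assms(2,3)
proof (induction "card (comp_crits a w)" arbitrary: a w d rule: less_induct)
  case less
  let ?C = "comp_crits a w"
  define c where "c = Max ?C"
  have fin: "finite ?C" and ne: "?C \<noteq> {}"
    using finite_comp_crits comp_crits_nonempty[OF less.prems] by auto
  have c: "c \<in> ?C" unfolding c_def using Max_in fin ne by blast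
  have max: "x \<le> c" if "x \<in> ?C" for x unfolding c_def using Max_ge fin that by blast
  obtain \<sigma> where \<sigma>: "critical T f \<sigma>" "\<sigma> \<subseteq> comp_verts a w" "f \<sigma> \<le> a" "c = f \<sigma>"
    using c unfolding comp_crits_eq by blast
  have "\<sigma> \<in> simplices T" using \<sigma>(1) by (simp add: critical_def)
  then show ?case
  proof (cases rule: simplex_cases)
    case (vertex v)
    then have eq: "component (sublevel T f a) w = component (sublevel T f a) v"
      using \<sigma>(2) comp_verts_eq by simp
    have "comp_crits a v = {f {v}}"
      using \<sigma> vertex max unfolding eq by (intro comp_crits_vertex) auto
    then have C: "?C = {f {v}}" unfolding eq .
    have "subtree_at T f d (f {v}) \<langle>\<langle>\<rangle>, f {v}, \<langle>\<rangle>\<rangle>"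
      using vertex \<sigma>(1) by (intro subtree_at.critical_vertex) auto
    then show ?thesis unfolding C
      by (intro exI[of _ "\<langle>\<langle>\<rangle>, f {v}, \<langle>\<rangle>\<rangle>"]) (simp add: merge_tree_def)
  next
    case (edge p q)
    obtain \<epsilon> where \<epsilon>: "precedes_by T f c \<epsilon>" using ex_precedes_by by blast
    let ?b = "c - \<epsilon>"
    have bc: "?b < c" using \<epsilon> by (simp add: precedes_by_def)
    \<comment> \<open>Stated for either naming of the endpoints, so that \<open>u\<close> can be the
      end with the smaller minimum.\<close>
    have main: ?thesis
      if uv: "\<sigma> = {u, v}" "{u, v} \<in> edges T"
        and min: "Min (comp_crits ?b u) < Min (comp_crits ?b v)" for u v
    proof -
      have crit: "critical T f {u, v}" and c_eq: "c = f {u, v}" using \<sigma> uv by auto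
      have eq: "component (sublevel T f a) w = component (sublevel T f a) u"
        using uv(1) \<sigma>(2) comp_verts_eq by blast
      have C: "?C = insert c (comp_crits ?b u \<union> comp_crits ?b v)"
        using comp_crits_edge[OF uv(2) crit, of a \<epsilon>] max \<epsilon> \<sigma>(3,4) unfolding eq c_eq by simp
      have notin: "c \<notin> comp_crits ?b u" "c \<notin> comp_crits ?b v"
        using bc unfolding comp_crits_eq by auto
      \<comment> \<open>Both sets are contained in \<open>?C\<close> and miss
        \<open>c\<close>.\<close>
      have small: "card (comp_crits ?b u) < card ?C" "card (comp_crits ?b v) < card ?C"
        using C notin by (intro psubset_card_mono finite_comp_crits; blast)+
      note ends = critical_edge_ends_below[OF uv(2) crit \<epsilon>[unfolded c_eq], folded c_eq]
      obtain Mu where Mu: "subtree_at T f d (Max (comp_crits ?b u)) Mu" "merge_tree Mu"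
          "distinct (inorder Mu)" "set_tree Mu = comp_crits ?b u"
        using less.hyps[OF small(1) ends(1,3)] by blast
      obtain Mv where Mv: "subtree_at T f (opposite d) (Max (comp_crits ?b v)) Mv" "merge_tree Mv"
          "distinct (inorder Mv)" "set_tree Mv = comp_crits ?b v"
        using less.hyps[OF small(2) ends(2,4)] by blast
      have "subtree_at T f d c (branch d Mu c Mv)"
        using subtree_at.critical_edge[OF uv(2) crit c_eq \<epsilon> refl refl min Mu(1) Mv(1)] .
      moreover have "comp_crits ?b u \<inter> comp_crits ?b v = {}"
        using comp_crits_disjoint[OF uv(2) assms(1)] bc c_eq by simp
      then have "distinct (inorder (branch d Mu c Mv))"
        using Mu Mv notin by (simp add: branch_simps)
      moreover have "merge_tree (branch d Mu c Mv)"
        using Mu(2) Mv(2) by (simp add: merge_tree_def branch_simps)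
      moreover have "set_tree (branch d Mu c Mv) = ?C"
        using Mu(4) Mv(4) C by (simp add: branch_simps)
      ultimately show ?thesis unfolding c_def[symmetric] by blast
    qed
    have crit: "critical T f {p, q}" and c_eq: "c = f {p, q}" using \<sigma> edge by auto
    note ends = critical_edge_ends_below[OF edge(3) crit \<epsilon>[unfolded c_eq], folded c_eq]
    have "Min (comp_crits ?b p) \<in> comp_crits ?b p" "Min (comp_crits ?b q) \<in> comp_crits ?b q"
      using ends by (intro Min_in finite_comp_crits comp_crits_nonempty; simp)+
    moreover have "comp_crits ?b p \<inter> comp_crits ?b q = {}"
      using comp_crits_disjoint[OF edge(3) assms(1)] bc c_eq by simp
    \<comment> \<open>The minima belong to disjoint sets, so one of the two strict inequalities that
      \<open>critical_edge\<close> asks for holds.\<close>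
    ultimately have "Min (comp_crits ?b p) \<noteq> Min (comp_crits ?b q)" by force
    then consider "Min (comp_crits ?b p) < Min (comp_crits ?b q)"
      | "Min (comp_crits ?b q) < Min (comp_crits ?b p)" by linarith
    then show ?thesis
    proof cases
      case 1
      then show ?thesis using main edge by blast
    next
      case 2
      moreover have "\<sigma> = {q, p}" "{q, p} \<in> edges T" using edge by (auto simp: insert_commute)
      ultimately show ?thesis using main by blast
    qed
  qed
qed

end

text \<open>Uniqueness makes the induced tree a function of \<open>f\<close>; distinct labels that
  exhaust the critical values make the nodes correspond bijectively to them.\<close>

theorem theorem9:
  fixes T :: "'a graph" and f :: "'a set \<Rightarrow> real"
  assumes "is_tree T" and "discrete_morse T f"
  shows "\<exists>M. induces T f M \<and> (\<forall>M'. induces T f M' \<longrightarrow> M' = M) \<and> merge_tree M \<and>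
    distinct (inorder M) \<and> set_tree M = critical_values T f"
proof -
  interpret morse_graph T f
    using assms by unfold_locales (auto simp: is_tree_def)
  have conn: "connected_graph T" and acyclic: "\<nexists>p. is_cycle T p"
    using assms by (auto simp: is_tree_def)
  obtain w where w: "w \<in> verts T" using conn by (auto simp: connected_graph_def)
  \<comment> \<open>At the largest value the sublevel graph is all of \<open>T\<close>, which by
    connectedness is a single component, so \<open>ex_subtree_at\<close> applies to it.\<close>
  define a where "a = Max (f ` simplices T)"
  have a: "f \<sigma> \<le> a" if "\<sigma> \<in> simplices T" for \<sigma>
    using that finite_simplices by (simp add: a_def)
  have "verts (sublevel T f a) = verts T" "edges (sublevel T f a) = edges T"
    using a simplices_intros by (auto simp: sublevel_def)
  then have "reachable (sublevel T f a) w x" if "reachable T w x" for x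
    using that by (auto intro: reachable_mono)
  then have "verts T \<subseteq> comp_verts a w"
    using w conn by (auto simp: comp_verts_def connected_graph_def)
  then have "\<sigma> \<subseteq> comp_verts a w" if "\<sigma> \<in> simplices T" for \<sigma>
    using that graph by (auto simp: simplices_def is_graph_def)
  then have "comp_crits a w = critical_values T f"
    using a unfolding comp_crits_eq by (auto simp: critical_values_in_def critical_def)
  then obtain M where "induces T f M" "merge_tree M" "distinct (inorder M)"
      "set_tree M = critical_values T f"
    using ex_subtree_at[OF acyclic w a[OF simplices_intros(1)[OF w]], of L]
    by (auto simp: induces_def)
  then show ?thesis using subtree_at_unique unfolding induces_def by blast
qed

end
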